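(* For an integer $n\ge1$ and $t_1,\dots,t_n\in(0,\infty)$, let $$\Phi_n(x)=\int_{-1}^{1}\cdots\int_{-1}^{1}\ \prod_{i=1}^{n}p_{t_i}(x_{i-1}-x_i)\,dx_1\cdots dx_n,\qquad x_0=x\in(-1,1).$$ Then there exist a positive integer $n$ and real numbers $t_1,t_2,\dots,t_n\in(0,\infty)$ such that the function $\Phi_n$ is not concave on $(-1,1)$.
   Context: $p_t(x)=\frac{1}{\sqrt{2\pi t}}e^{-x^2/(2t)}$, $t>0$, $x\in\mathbb{R}$, is the one-dimensional Gaussian density. *)

theory Defs
  imports "HOL-Probability.Probability"
begin

definition gauss_density :: "real \<Rightarrow> real \<Rightarrow> real" where
  "gauss_density t x = 1 / sqrt (2 * pi * t) * exp (- (x\<^sup>2) / (2 * t))"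

lemma gauss_density_eq_normal_density:
  assumes "t > 0"
  shows "gauss_density t x = normal_density 0 (sqrt t) x"
  using assms by (simp add: gauss_density_def normal_density_def)

(* The n-fold integral is taken over the cube [-1,1]^n with respect to Lebesgue measure on
   real-valued functions indexed by {1..n}; the update y(0 := x) implements x_0 = x.
   Only the values t 1, ..., t n matter. *)
definition Phi :: "nat \<Rightarrow> (nat \<Rightarrow> real) \<Rightarrow> real \<Rightarrow> real" where
  "Phi n t x =
     (LINT y : (\<Pi>\<^sub>E i\<in>{1..n}. {-1..1}) | (\<Pi>\<^sub>M i\<in>{1..n}. lborel).
        (\<Prod>i = 1..n. gauss_density (t i) ((y(0 := x)) (i - 1) - y i)))"

end

theory Submission
  imports Defs "HOL-Real_Asymp.Real_Asymp"
begin

text \<open>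
  Two integrations suffice. Write \<open>f(y)\<close> for the inner integral of \<open>p\<^sub>1(y - z)\<close> over
  \<open>z \<in> [-1,1]\<close>, so that for \<open>n = 2\<close>, \<open>t\<^sub>1 = s\<close> and \<open>t\<^sub>2 = 1\<close> the function in question is the
  convolution of the Gaussian \<open>p\<^sub>s\<close> with \<open>f\<close> restricted to \<open>[-1,1]\<close>. The formula makes sense for
  all real \<open>x\<close>, and its second derivative at the endpoint \<open>x = 1\<close> can be computed by integrating
  by parts twice:
  \[ \int_{-1}^1 p_s''(1-y) f(y)\,dy
     = -p_s'(0) f(1) - p_s(0) f'(1) + p_s'(2) f(-1) + p_s(2) f'(-1)
       + \int_{-1}^1 p_s(1-y) f''(y)\,dy . \]
  Here \<open>p\<^sub>s'(0) = 0\<close>, the terms at distance 2 are exponentially small as \<open>s \<rightarrow> 0\<close>, and the last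
  integral stays bounded because \<open>p\<^sub>s\<close> has mass 1. Since
  \<open>f'(1) = p\<^sub>1(2) - p\<^sub>1(0) < 0\<close>, the term \<open>-p\<^sub>s(0) f'(1)\<close> is positive and of order \<open>s\<^sup>-\<^sup>1\<^sup>/\<^sup>2\<close>, so it dominates
  (lemma \<open>gauss_smoothing_deriv2_pos\<close>). Informally: cutting \<open>f\<close> off at \<open>1\<close> and smoothing
  produces a transition layer of width \<open>s\<^sup>1\<^sup>/\<^sup>2\<close>, whose inflection point is
  pushed from \<open>1\<close> into the interval by the negative slope of \<open>f\<close>.

  A positive second derivative at the right endpoint rules out concavity on the open interval,
  since it makes the first derivative increase just to the left of it
  (lemma \<open>not_concave_on_if_deriv2_pos_at_right_end\<close>).
\<close>

section \<open>Derivatives of the Gaussian density\<close>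

definition gauss_deriv :: "real \<Rightarrow> real \<Rightarrow> real" where
  "gauss_deriv t x = - (x / t) * gauss_density t x"

definition gauss_deriv2 :: "real \<Rightarrow> real \<Rightarrow> real" where
  "gauss_deriv2 t x = (x\<^sup>2 / t\<^sup>2 - 1 / t) * gauss_density t x"

lemma has_real_derivative_gauss_density:
  assumes "t > 0"
  shows "(gauss_density t has_real_derivative gauss_deriv t x) (at x)"
  unfolding gauss_deriv_def gauss_density_def [abs_def] using assms
  by (auto intro!: derivative_eq_intros simp: field_simps)

lemma has_real_derivative_gauss_deriv:
  assumes "t > 0"
  shows "(gauss_deriv t has_real_derivative gauss_deriv2 t x) (at x)"
proof -
  have "((\<lambda>x. - (x / t)) has_real_derivative - (1 / t)) (at x)"
    using assms by (auto intro!: derivative_eq_intros)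
  from DERIV_mult[OF this has_real_derivative_gauss_density[OF assms]] show ?thesis
    unfolding gauss_deriv_def [abs_def] gauss_deriv2_def
    by (simp add: algebra_simps power2_eq_square)
qed

lemma continuous_on_gauss_density [continuous_intros]:
  "continuous_on A g \<Longrightarrow> continuous_on A (\<lambda>x. gauss_density t (g x))"
  unfolding gauss_density_def divide_inverse by (intro continuous_intros)

lemma continuous_on_gauss_deriv [continuous_intros]:
  "continuous_on A g \<Longrightarrow> continuous_on A (\<lambda>x. gauss_deriv t (g x))"
  unfolding gauss_deriv_def divide_inverse by (intro continuous_intros)

lemma continuous_on_gauss_deriv2 [continuous_intros]:
  "continuous_on A g \<Longrightarrow> continuous_on A (\<lambda>x. gauss_deriv2 t (g x))"
  unfolding gauss_deriv2_def divide_inverse by (intro continuous_intros)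

lemma gauss_density_nonneg: "t > 0 \<Longrightarrow> gauss_density t x \<ge> 0"
  by (simp add: gauss_density_def)

lemma gauss_density_le:
  assumes "t > 0"
  shows "gauss_density t x \<le> 1 / sqrt (2 * pi * t)"
proof -
  have "exp (- (x\<^sup>2) / (2 * t)) \<le> 1"
    using assms by (simp add: divide_nonpos_pos)
  thus ?thesis
    unfolding gauss_density_def using assms by (intro mult_left_le) auto
qed

lemma integral_gauss_density_le_1:
  assumes "t > 0"
  shows "integral {a..b} (\<lambda>y. gauss_density t (x - y)) \<le> 1"
proof -
  have eq: "gauss_density t (x - y) = normal_density x (sqrt t) y" for y
    using assms by (simp add: gauss_density_def normal_density_def power2_commute)
  have "(normal_density x (sqrt t) has_integral 1) UNIV"
    using has_integral_integral_lborel[of "normal_density x (sqrt t)"] assms by simp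
  hence UNIV: "((\<lambda>y. gauss_density t (x - y)) has_integral 1) UNIV"
    by (simp add: eq [abs_def])
  have "integral {a..b} (\<lambda>y. gauss_density t (x - y))
          \<le> integral UNIV (\<lambda>y. gauss_density t (x - y))"
    using UNIV assms
    by (intro integral_subset_le integrable_continuous_real continuous_intros)
      (auto simp: gauss_density_nonneg has_integral_iff)
  also have "\<dots> = 1"
    using UNIV by (rule integral_unique)
  finally show ?thesis .
qed

section \<open>Convolution over an interval\<close>

lemma has_real_derivative_convolution:
  fixes p p' f :: "real \<Rightarrow> real"
  assumes p: "\<And>u. (p has_real_derivative p' u) (at u)"
    and p': "continuous_on UNIV p'" and f: "continuous_on {a..b} f"
  shows "((\<lambda>x. integral {a..b} (\<lambda>y. p (x - y) * f y)) has_real_derivative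
            integral {a..b} (\<lambda>y. p' (x - y) * f y)) (at x)"
proof -
  have "continuous_on UNIV p"
    using p by (meson DERIV_continuous continuous_at_imp_continuous_on)
  note [continuous_intros] =
    continuous_on_compose2[OF this] continuous_on_compose2[OF p'] continuous_on_compose2[OF f]
  show ?thesis
    unfolding cbox_interval [symmetric]
  proof (rule leibniz_rule_field_derivative)
    fix x t :: real
    show "((\<lambda>x. p (x - t) * f t) has_real_derivative p' (x - t) * f t) (at x)"
      by (rule derivative_eq_intros refl DERIV_chain2[OF p])+ simp
    show "(\<lambda>y. p (x - y) * f y) integrable_on cbox a b"
      by (intro integrable_continuous continuous_intros) auto
    show "continuous_on (UNIV \<times> cbox a b) (\<lambda>(x, t). p' (x - t) * f t)"
      unfolding case_prod_unfold by (intro continuous_intros) auto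
  qed auto
qed

section \<open>Smoothing a function cut off at an endpoint\<close>

text \<open>
  Both integrations by parts are done at once: \<open>- p'(1 - y) f(y) - p(1 - y) f'(y)\<close> is an
  antiderivative of \<open>p''(1 - y) f(y) - p(1 - y) f''(y)\<close>. The boundary term \<open>- p'(0) f(1)\<close> vanishes.
\<close>

lemma integral_gauss_deriv2_by_parts:
  assumes s: "s > 0"
    and f: "\<And>y. (f has_real_derivative f' y) (at y)"
    and f': "\<And>y. (f' has_real_derivative f'' y) (at y)"
    and f'': "continuous_on {-1..1} f''"
  shows "integral {-1..1} (\<lambda>y. gauss_deriv2 s (1 - y) * f y) =
           - gauss_density s 0 * f' 1 + gauss_deriv s 2 * f (-1) + gauss_density s 2 * f' (-1)
           + integral {-1..1} (\<lambda>y. gauss_density s (1 - y) * f'' y)"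
proof -
  define G where "G y = - gauss_deriv s (1 - y) * f y - gauss_density s (1 - y) * f' y" for y
  have "continuous_on {-1..1} f"
    using f by (meson DERIV_continuous continuous_at_imp_continuous_on)
  hence int: "(\<lambda>y. gauss_deriv2 s (1 - y) * f y) integrable_on {-1..1}"
      "(\<lambda>y. gauss_density s (1 - y) * f'' y) integrable_on {-1..1}"
    by (intro integrable_continuous_real continuous_intros f''; assumption)+
  have "(G has_real_derivative
          gauss_deriv2 s (1 - y) * f y - gauss_density s (1 - y) * f'' y) (at y)" for y
    unfolding G_def
    by (rule derivative_eq_intros f f' refl
          DERIV_chain2[OF has_real_derivative_gauss_density[OF s]]
          DERIV_chain2[OF has_real_derivative_gauss_deriv[OF s]])+ simp
  hence "((\<lambda>y. gauss_deriv2 s (1 - y) * f y - gauss_density s (1 - y) * f'' y)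
            has_integral G 1 - G (-1)) {-1..1}"
    by (intro fundamental_theorem_of_calculus)
      (auto simp flip: has_real_derivative_iff_has_vector_derivative
            intro: has_field_derivative_at_within)
  hence "integral {-1..1} (\<lambda>y. gauss_deriv2 s (1 - y) * f y)
           - integral {-1..1} (\<lambda>y. gauss_density s (1 - y) * f'' y) = G 1 - G (-1)"
    using int by (simp add: integral_unique flip: integral_diff)
  thus ?thesis
    by (simp add: G_def gauss_deriv_def)
qed

text \<open>
  The boundary term \<open>- p\<^sub>s(0) f'(1)\<close> blows up like \<open>s\<^sup>-\<^sup>1\<^sup>/\<^sup>2\<close>, while everything else is
  bounded below: the integral of \<open>p\<^sub>s(1 - y) f''(y)\<close> is at least \<open>- max \<bar>f''\<bar>\<close> because
  \<open>p\<^sub>s\<close> has mass 1, and the terms at distance 2 tend to 0 exponentially fast.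
\<close>

lemma gauss_smoothing_deriv2_pos:
  assumes f: "\<And>y. (f has_real_derivative f' y) (at y)"
    and f': "\<And>y. (f' has_real_derivative f'' y) (at y)"
    and f'': "continuous_on {-1..1} f''"
    and neg: "f' 1 < 0"
  shows "\<forall>\<^sub>F s in at_right 0. integral {-1..1} (\<lambda>y. gauss_deriv2 s (1 - y) * f y) > 0"
proof -
  have "compact (f'' ` {-1..1})"
    using f'' by (intro compact_continuous_image) auto
  then obtain M where M: "M > 0" "\<And>y. y \<in> {-1..1} \<Longrightarrow> \<bar>f'' y\<bar> \<le> M"
    using compact_imp_bounded[of "f'' ` {-1..1}"] by (auto simp: bounded_pos)
  define a b c where "a = - f' 1" and "b = f (-1)" and "c = f' (-1)"
  have "a > 0"
    using neg by (simp add: a_def)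
  hence "filterlim (\<lambda>s. 1 / sqrt (2 * pi * s) * a
            + - (2 / s) * (1 / sqrt (2 * pi * s) * exp (- 4 / (2 * s))) * b
            + 1 / sqrt (2 * pi * s) * exp (- 4 / (2 * s)) * c) at_top (at_right 0)"
    by real_asymp
  hence "\<forall>\<^sub>F s in at_right 0. 1 / sqrt (2 * pi * s) * a
            + - (2 / s) * (1 / sqrt (2 * pi * s) * exp (- 4 / (2 * s))) * b
            + 1 / sqrt (2 * pi * s) * exp (- 4 / (2 * s)) * c > M"
    by (simp add: filterlim_at_top_dense)
  moreover have "\<forall>\<^sub>F s in at_right 0. s > (0::real)"
    by (rule eventually_at_right_less)
  ultimately show ?thesis
  proof eventually_elim
    case (elim s)
    have "- M \<le> - M * integral {-1..1} (\<lambda>y. gauss_density s (1 - y))"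
      using integral_gauss_density_le_1[of s "-1" 1 1] elim M(1) by simp
    also have "\<dots> = integral {-1..1} (\<lambda>y. gauss_density s (1 - y) * (- M))"
      by (simp add: mult.commute)
    also have "\<dots> \<le> integral {-1..1} (\<lambda>y. gauss_density s (1 - y) * f'' y)"
    proof (intro integral_le integrable_continuous_real continuous_intros f'')
      fix y :: real
      assume "y \<in> {-1..1}"
      with M(2)[of y] show "gauss_density s (1 - y) * (- M) \<le> gauss_density s (1 - y) * f'' y"
        using elim by (intro mult_left_mono gauss_density_nonneg) auto
    qed
    finally show ?case
      using integral_gauss_deriv2_by_parts[OF _ f f' f'', of s] elim
      by (simp add: gauss_deriv_def gauss_density_def a_def b_def c_def)
  qed
qed

text \<open>
  Concavity makes the first derivative antitone on the open interval and hence, by continuity,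
  bounded below there by its value at the right endpoint. A positive second derivative at the
  endpoint says the opposite just to the left of it.
\<close>

lemma not_concave_on_if_deriv2_pos_at_right_end:
  fixes F F' :: "real \<Rightarrow> real"
  assumes "a < b" and F: "\<And>x. (F has_real_derivative F' x) (at x)"
    and F': "(F' has_real_derivative D) (at b)" "D > 0"
  shows "\<not> concave_on {a<..<b} F"
proof
  assume "concave_on {a<..<b} F"
  hence conv: "convex_on {a<..<b} (\<lambda>x. - F x)"
    by (simp add: concave_on_def)
  have tangent: "- F y - - F x \<ge> - F' x * (y - x)" if "x \<in> {a<..<b}" "y \<in> {a<..<b}" for x y
    using that
    by (intro convex_on_imp_above_tangent[OF conv])
      (auto intro!: DERIV_minus has_field_derivative_at_within[OF F] simp: interior_open)
  have antimono: "F' y \<le> F' x" if "a < x" "x < y" "y < b" for x y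
  proof -
    have "F' y * (y - x) \<le> F' x * (y - x)"
      using tangent[of x y] tangent[of y x] that by (simp add: algebra_simps)
    thus ?thesis
      using that by simp
  qed
  have lower: "F' b \<le> F' x" if "a < x" "x < b" for x
  proof (rule tendsto_upperbound)
    show "(F' \<longlongrightarrow> F' b) (at_left b)"
      using DERIV_isCont[OF F'(1)] by (auto simp: isCont_def intro: tendsto_within_subset)
    show "\<forall>\<^sub>F y in at_left b. F' y \<le> F' x"
      using eventually_at_left_real[OF \<open>x < b\<close>] by eventually_elim (use that antimono in auto)
  qed simp
  obtain d where d: "d > 0" "\<And>h. h > 0 \<Longrightarrow> h < d \<Longrightarrow> F' (b - h) < F' b"
    using DERIV_pos_inc_left[OF F'] by blast
  define h where "h = min d (b - a) / 2"
  have "h > 0" "h < d" "h < b - a"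
    using d(1) \<open>a < b\<close> by (auto simp: h_def)
  thus False
    using d(2)[of h] lower[of "b - h"] by simp
qed

section \<open>The two-fold integral\<close>

lemma lborel_integral_indicator_cube:
  fixes f :: "real \<Rightarrow> real"
  assumes "continuous_on {a..b} f"
  shows "(LINT y|lborel. indicator {a..b} y * f y) = integral {a..b} f"
proof -
  have "set_integrable lborel {a..b} f"
    using assms by (rule borel_integrable_atLeastAtMost')
  thus ?thesis
    using set_borel_integral_eq_integral(2)[of "{a..b}" f]
    by (simp add: set_lebesgue_integral_def)
qed

text \<open>
  Fubini's theorem applies because on the square the integrand is bounded by the product of
  the two maxima.
\<close>

lemma Phi_2:
  assumes "t 1 > 0" "t 2 > 0"
  shows "Phi 2 t x = integral {-1..1} (\<lambda>y. gauss_density (t 1) (x - y) *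
           integral {-1..1} (\<lambda>z. gauss_density (t 2) (y - z)))"
proof -
  interpret product_sigma_finite "\<lambda>_::nat. lborel :: real measure" ..
  let ?I = "indicator {-1..1} :: real \<Rightarrow> real"
  define g where "g u v = (?I u * ?I v) *
      (gauss_density (t 1) (x - u) * gauss_density (t 2) (u - v))" for u v
  have [measurable]: "gauss_density s \<in> borel_measurable borel" for s
    unfolding gauss_density_def [abs_def] by measurable
  have I12: "{1..2} = insert 2 {1::nat}"
    by auto
  have cube: "indicator (\<Pi>\<^sub>E i\<in>insert 2 {1::nat}. {-1..1::real}) y = ?I (y 1) * ?I (y 2)"
    if "y \<in> space (\<Pi>\<^sub>M i\<in>insert 2 {1::nat}. lborel)" for y
    using that by (auto simp: indicator_def space_PiM PiE_iff)
  have "Phi 2 t x = (LINT y|(\<Pi>\<^sub>M i\<in>insert 2 {1::nat}. lborel). g (y 1) (y 2))"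
    unfolding Phi_def set_lebesgue_integral_def I12
    by (rule Bochner_Integration.integral_cong) (simp_all add: cube [simplified] g_def)
  also have "\<dots> = (LINT y|(\<Pi>\<^sub>M i\<in>{1::nat}. lborel). LINT z|lborel.
                   g ((y(2 := z)) 1) ((y(2 := z)) 2))"
  proof (rule product_integral_insert)
    let ?C = "1 / sqrt (2 * pi * t 1) * (1 / sqrt (2 * pi * t 2))"
    have "integrable (\<Pi>\<^sub>M i\<in>insert 2 {1::nat}. lborel)
            (\<lambda>y. (\<Prod>i\<in>insert 2 {1}. ?I (y i)) * ?C)"
      by (intro integrable_mult_left product_integrable_prod) auto
    thus "integrable (\<Pi>\<^sub>M i\<in>insert 2 {1::nat}. lborel) (\<lambda>y. g (y 1) (y 2))"
    proof (rule Bochner_Integration.integrable_bound)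
      show "(\<lambda>y. g (y 1) (y 2)) \<in> borel_measurable (\<Pi>\<^sub>M i\<in>insert 2 {1::nat}. lborel)"
        unfolding g_def by measurable
      have "norm (g u v) \<le> norm (?I u * ?I v * ?C)" for u v
      proof -
        have "gauss_density (t 1) (x - u) * gauss_density (t 2) (u - v) \<le> ?C"
          using gauss_density_le gauss_density_nonneg assms by (intro mult_mono) auto
        thus ?thesis
          using assms by (auto simp: g_def gauss_density_nonneg split: split_indicator)
      qed
      thus "AE y in (\<Pi>\<^sub>M i\<in>insert 2 {1::nat}. lborel).
              norm (g (y 1) (y 2)) \<le> norm ((\<Prod>i\<in>insert 2 {1}. ?I (y i)) * ?C)"
        by (simp add: mult.commute)
    qed
  qed auto
  also have "\<dots> = (LINT u|lborel. LINT v|lborel. g u v)"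
    by (simp, rule product_integral_singleton) (simp add: g_def)
  also have "\<dots> = (LINT u|lborel. ?I u * (gauss_density (t 1) (x - u) *
                     integral {-1..1} (\<lambda>v. gauss_density (t 2) (u - v))))"
  proof (rule Bochner_Integration.integral_cong)
    fix u :: real
    have "(LINT v|lborel. g u v) = (LINT v|lborel. (?I u * gauss_density (t 1) (x - u)) *
            (?I v * gauss_density (t 2) (u - v)))"
      by (simp add: g_def mult_ac)
    also have "\<dots> = (?I u * gauss_density (t 1) (x - u)) *
            integral {-1..1} (\<lambda>v. gauss_density (t 2) (u - v))"
      by (subst integral_mult_right_zero, subst lborel_integral_indicator_cube)
        (auto intro!: continuous_intros)
    finally show "(LINT v|lborel. g u v) = ?I u * (gauss_density (t 1) (x - u) *
            integral {-1..1} (\<lambda>v. gauss_density (t 2) (u - v)))"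
      by (simp add: mult_ac)
  qed simp
  also have "\<dots> = integral {-1..1} (\<lambda>y. gauss_density (t 1) (x - y) *
           integral {-1..1} (\<lambda>z. gauss_density (t 2) (y - z)))"
  proof (rule lborel_integral_indicator_cube)
    have "continuous_on ({-1..1} \<times> cbox (-1) 1) (\<lambda>(y, z). gauss_density (t 2) (y - z))"
      unfolding case_prod_unfold by (intro continuous_intros)
    from integral_continuous_on_param[OF this]
    show "continuous_on {-1..1} (\<lambda>y. gauss_density (t 1) (x - y) *
            integral {-1..1} (\<lambda>z. gauss_density (t 2) (y - z)))"
      by (intro continuous_intros) simp
  qed
  finally show ?thesis .
qed

lemma has_real_derivative_integral_gauss_density:
  assumes "t > 0" "a \<le> b"
  shows "((\<lambda>y. integral {a..b} (\<lambda>z. gauss_density t (y - z))) has_real_derivative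
           gauss_density t (y - a) - gauss_density t (y - b)) (at y)"
proof -
  have "((\<lambda>z. - gauss_density t (y - z)) has_real_derivative gauss_deriv t (y - z)) (at z)" for z
    by (rule derivative_eq_intros refl
          DERIV_chain2[OF has_real_derivative_gauss_density[OF assms(1)]])+ simp
  hence "((\<lambda>z. gauss_deriv t (y - z)) has_integral
           - gauss_density t (y - b) - - gauss_density t (y - a)) {a..b}"
    by (intro fundamental_theorem_of_calculus assms)
      (auto simp flip: has_real_derivative_iff_has_vector_derivative
            intro: has_field_derivative_at_within)
  hence "integral {a..b} (\<lambda>z. gauss_deriv t (y - z)) =
           gauss_density t (y - a) - gauss_density t (y - b)"
    by (simp add: integral_unique)
  thus ?thesis
    using has_real_derivative_convolution[of "gauss_density t" "gauss_deriv t" a b "\<lambda>_. 1" y]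
      has_real_derivative_gauss_density[OF assms(1)]
    by (simp add: continuous_on_gauss_deriv)
qed

theorem proposition3p1:
  "\<exists>n::nat. n \<ge> 1 \<and>
     (\<exists>t::nat \<Rightarrow> real. (\<forall>i\<in>{1..n}. t i > 0) \<and> \<not> concave_on {-1<..<1} (Phi n t))"
proof -
  define f where "f y = integral {-1..1} (\<lambda>z. gauss_density 1 (y - z))" for y
  define f' where "f' y = gauss_density 1 (y + 1) - gauss_density 1 (y - 1)" for y
  define f'' where "f'' y = gauss_deriv 1 (y + 1) - gauss_deriv 1 (y - 1)" for y
  have f: "(f has_real_derivative f' y) (at y)" for y
    using has_real_derivative_integral_gauss_density[of 1 "-1" 1 y]
    by (simp add: f_def [abs_def] f'_def)
  have f': "(f' has_real_derivative f'' y) (at y)" for y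
    unfolding f'_def f''_def
    by (rule derivative_eq_intros refl
          DERIV_chain2[OF has_real_derivative_gauss_density[OF zero_less_one]])+ simp
  have "continuous_on {-1..1} f''"
    unfolding f''_def by (intro continuous_intros)
  moreover have "f' 1 < 0"
    by (simp add: f'_def gauss_density_def divide_strict_right_mono)
  ultimately have "\<forall>\<^sub>F s in at_right 0.
      integral {-1..1} (\<lambda>y. gauss_deriv2 s (1 - y) * f y) > 0"
    using f f' by (intro gauss_smoothing_deriv2_pos)
  moreover have "\<forall>\<^sub>F s in at_right 0. s > (0::real)"
    by (rule eventually_at_right_less)
  ultimately have "\<forall>\<^sub>F s in at_right 0.
      s > 0 \<and> integral {-1..1} (\<lambda>y. gauss_deriv2 s (1 - y) * f y) > 0"
    by eventually_elim simp
  then obtain s where s: "s > 0" "integral {-1..1} (\<lambda>y. gauss_deriv2 s (1 - y) * f y) > 0"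
    using eventually_happens trivial_limit_at_right_real by blast
  define t where "t i = (if i = 1 then s else 1)" for i :: nat
  have Phi: "Phi 2 t = (\<lambda>x. integral {-1..1} (\<lambda>y. gauss_density s (x - y) * f y))"
    using Phi_2[of t] s(1) by (auto simp: t_def f_def)
  have cont: "continuous_on {-1..1} f"
    using f by (meson DERIV_continuous continuous_at_imp_continuous_on)
  have "\<not> concave_on {-1<..<1} (Phi 2 t)"
    unfolding Phi
    by (rule not_concave_on_if_deriv2_pos_at_right_end[OF _ _ _ s(2)])
      (auto intro!: has_real_derivative_convolution has_real_derivative_gauss_density
         has_real_derivative_gauss_deriv continuous_intros cont s(1))
  moreover have "\<forall>i\<in>{1..2}. t i > 0"
    using s(1) by (simp add: t_def)
  ultimately show ?thesis
    by (intro exI[of _ 2]) auto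
qed

end
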